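(* Let $k\in\frac12\mathbb{Z}$, let $V$ be a complex vector space, and let $\rho:\widetilde{\mathrm{SL}_2}(\mathbb{Z})\to \mathrm{GL}(V)$ be a representation. Then the induction map $$\mathrm{Ind}: M_k(\widetilde{\mathrm{SL}_2}(\mathbb{Z}),\rho)\oplus M_k(\widetilde{\mathrm{SL}_2}(\mathbb{Z}),\rho^R)\to M_k(\widetilde{\mathrm{GL}_2}(\mathbb{Z}),\mathrm{Ind}\,\rho),\qquad (f,g)\mapsto \mathrm{Ind}(f,g),$$ is an isomorphism (of complex vector spaces).
   Context: **Half-planes.** $\mathbb{H}^{+}=\{z\in\mathbb{C}: \Im z>0\}$, $\mathbb{H}^{-}=\{z\in\mathbb{C}: \Im z<0\}$, $\mathbb{H}^*=\mathbb{H}^+\cup\mathbb{H}^-$. $\mathrm{GL}_2(\mathbb{Z})$ acts on $\mathbb{H}^*$ by $\left(\begin{smallmatrix}a&b\\c&d\end{smallmatrix}\right)z=\frac{az+b}{cz+d}$. Put $R=\left(\begin{smallmatrix}-1&0\\0&1\end{smallmatrix}\right)$, so $Rz=-z$. **The group $\widetilde{\mathrm{GL}_2}(\mathbb{Z})$.** For $\gamma=\left(\begin{smallmatrix}a&b\\c&d\end{smallmatrix}\right)\in\mathrm{GL}_2(\mathbb{Z})$ let $\chi(\gamma)=c$ if $c\neq0$ and $\chi(\gamma)=d$ if $c=0$. For nonzero reals $a,b$ let $(a,b)=-1$ if $a<0$ and $b<0$, and $(a,b)=1$ otherwise. For $\alpha,\beta\in\mathrm{GL}_2(\mathbb{Z})$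 set $$A(\alpha,\beta)=(\det\alpha,\det\beta)\left(\frac{\chi(\alpha\beta)}{\chi(\alpha)},\frac{\chi(\alpha\beta)}{\chi(\beta)\det\alpha}\right)\in\{\pm1\}.$$ This is a $2$-cocycle. $\widetilde{\mathrm{GL}_2}(\mathbb{Z})$ is the group of pairs $[\gamma,\epsilon]$ with $\gamma\in\mathrm{GL}_2(\mathbb{Z})$, $\epsilon\in\{\pm1\}$, and product $[\alpha,\epsilon][\beta,\delta]=[\alpha\beta,A(\alpha,\beta)\epsilon\delta]$. Put $\widetilde R=[R,1]$. For $\gamma\in\mathrm{SL}_2(\mathbb{Z})$ set $B(\gamma)=(\chi(\gamma),\chi(\gamma R))$ (the Hilbert symbol, i.e. $B(\gamma)=-1$ if $\chi(\gamma)<0$ and $\chi(\gamma R)<0$, and $B(\gamma)=1$ otherwise). **The group $\widetilde{\mathrm{SL}_2}(\mathbb{Z})$.** It is the group of pairs $(\gamma,\phi)$ with $\gamma=\left(\begin{smallmatrix}*&*\\c&d\end{smallmatrix}\right)\in\mathrm{SL}_2(\mathbb{Z})$ and $\phi$ holomorphic on $\mathbb{H}^+$ with $\phi(z)^2=cz+d$, with product $(\alpha,\phi(z))(\beta,\psi(z))=(\alpha\beta,\phi(\beta z)\psi(z))$. Fix an embedding $\iota:\widetilde{\mathrm{SL}_2}(\mathbb{Z})\to\widetilde{\mathrm{GL}_2}(\mathbb{Z})$ lifting the inclusion $\mathrm{SL}_2(\mathbb{Z})\subset\mathrm{GL}_2(\mathbb{Z})$ (i.e. $\iota(\alpha,\phi)=[\beta,\epsilon]$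 implies $\alpha=\beta$); such embeddings exist, and the image is $\{[\gamma,\epsilon]:\det\gamma=1\}$. Identify $\widetilde{\mathrm{SL}_2}(\mathbb{Z})$ with this image. For $\gamma\in\mathrm{SL}_2(\mathbb{Z})$ let $\phi_\gamma^+:\mathbb{H}^+\to\mathbb{C}$ be the function with $\iota(\gamma,\phi_\gamma^+)=[\gamma,1]$; then $\iota(\gamma,\epsilon\phi^+_\gamma)=[\gamma,\epsilon]$. **Weight $k$ action** ($k\in\frac12\mathbb{Z}$). For a function $f$ on $\mathbb{H}^*$ (with values in $\mathbb{C}$ or a complex vector space) write $f^\pm=f|_{\mathbb{H}^\pm}$. For $[\gamma,\epsilon]\in\widetilde{\mathrm{GL}_2}(\mathbb{Z})$ define $f|_k[\gamma,\epsilon]$ by: - if $\det\gamma=1$: $(f|_k[\gamma,\epsilon])^+(z)=f^+(\gamma z)(\epsilon\phi_\gamma^+(z))^{-2k}$ and $(f|_k[\gamma,\epsilon])^-(z)=f^-(\gamma z)(\epsilon B(\gamma)\phi^+_{R\gamma R}(-z))^{-2k}$; - if $\det\gamma=-1$: $(f|_k[\gamma,\epsilon])^+(z)=f^-(\gamma z)(i\epsilon A(R,\gamma)\phi^+_{R\gamma}(z))^{-2k}$ and $(f|_k[\gamma,\epsilon])^-(z)=f^+(\gamma z)(i\epsilon A(R,\gamma)B(R\gamma)\phi^+_{\gamma R}(-z))^{-2k}$. For $f$ defined only on $\mathbb{H}^+$ and $[\gamma,\epsilon]$ with $\det\gamma=1$, $(f|_k[\gamma,\epsilon])(z)=f(\gamma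 z)(\epsilon\phi^+_\gamma(z))^{-2k}$. **Modular forms.** A function $f$ with values in a complex vector space $V$ is holomorphic if $\lambda\circ f$ is holomorphic for every linear functional $\lambda:V\to\mathbb{C}$. For a representation $\rho:\widetilde{\mathrm{GL}_2}(\mathbb{Z})\to\mathrm{GL}(V)$, $M_k(\widetilde{\mathrm{GL}_2}(\mathbb{Z}),\rho)$ is the space of holomorphic $f:\mathbb{H}^*\to V$ with $f|_k\tilde\gamma=\rho(\tilde\gamma)f$ for all $\tilde\gamma\in\widetilde{\mathrm{GL}_2}(\mathbb{Z})$. For a representation $\rho:\widetilde{\mathrm{SL}_2}(\mathbb{Z})\to\mathrm{GL}(V)$, $M_k(\widetilde{\mathrm{SL}_2}(\mathbb{Z}),\rho)$ is the space of holomorphic $f:\mathbb{H}^+\to V$ with $f|_k\tilde\gamma=\rho(\tilde\gamma)f$ for all $\tilde\gamma\in\widetilde{\mathrm{SL}_2}(\mathbb{Z})$. (No growth condition is imposed in either case.) **Induction.** Let $\rho:\widetilde{\mathrm{SL}_2}(\mathbb{Z})\to\mathrm{GL}(V)$ be a representation. Set $\rho^R(\tilde\gamma)=\rho(\widetilde R\tilde\gamma\widetilde R^{-1})$ for $\tilde\gamma\in\widetilde{\mathrm{SL}_2}(\mathbb{Z})$. Let $\mathrm{Ind}\,V=V\oplus V$, written as column vectors with two entries in $V$. The induced representation $\mathrm{Ind}\,\rho:\widetilde{\mathrm{GL}_2}(\mathbb{Z})\to\mathrm{GL}(\mathrm{Ind}\,V)$ is realized by $$(\mathrm{Ind}\,\rho)(\tilde\gamma)=\begin{pmatrix}\rho(\tilde\gamma)&0\\0&\rho(\widetilde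 R\tilde\gamma\widetilde R^{-1})\end{pmatrix},\qquad (\mathrm{Ind}\,\rho)(\widetilde R\tilde\gamma)=\begin{pmatrix}0&\rho(\widetilde R\tilde\gamma\widetilde R^{-1})\\ \rho([I,-1])\rho(\tilde\gamma)&0\end{pmatrix}$$ for all $\tilde\gamma\in\widetilde{\mathrm{SL}_2}(\mathbb{Z})$. For $f\in M_k(\widetilde{\mathrm{SL}_2}(\mathbb{Z}),\rho)$ and $g\in M_k(\widetilde{\mathrm{SL}_2}(\mathbb{Z}),\rho^R)$, the function $\mathrm{Ind}(f,g):\mathbb{H}^*\to\mathrm{Ind}\,V$ is defined by $$\mathrm{Ind}(f,g)(z)=\begin{pmatrix}f(z)\\ g(z)\end{pmatrix}\ (z\in\mathbb{H}^+),\qquad \mathrm{Ind}(f,g)(z)=\begin{pmatrix}(-i)^{2k}g(-z)\\ i^{2k}f(-z)\end{pmatrix}\ (z\in\mathbb{H}^-).$$ *)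

theory Defs
  imports
    "HOL-Analysis.Analysis"
    "HOL-Library.Function_Algebras"
    "HOL-Algebra.Group"
begin

section \<open>Half-planes and integral matrices\<close>

definition Hplus :: "complex set" where "Hplus = {z. Im z > 0}"
definition Hminus :: "complex set" where "Hminus = {z. Im z < 0}"
definition Hstar :: "complex set" where "Hstar = Hplus \<union> Hminus"

text \<open>Throughout, a function on a set \<open>S\<close> of complex numbers is represented by the unique total
  function that agrees with it on \<open>S\<close> and is zero off \<open>S\<close>. In this way equality of
  functions on \<open>S\<close> is HOL equality, and the functions on \<open>S\<close> form a subspace of the space of all
  functions under the pointwise operations.\<close>

definition funs_on :: "complex set \<Rightarrow> (complex \<Rightarrow> 'b::zero) set" where
  "funs_on S = {f. \<forall>z. z \<notin> S \<longrightarrow> f z = 0}"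

type_synonym mat2 = "int^2^2"

definition GL2Z :: "mat2 set" where "GL2Z = {\<gamma>. invertible \<gamma>}"
definition SL2Z :: "mat2 set" where "SL2Z = {\<gamma>. det \<gamma> = 1}"

definition R_mat :: mat2 where
  "R_mat = vector [vector [-1, 0], vector [0, 1]]"

definition act :: "mat2 \<Rightarrow> complex \<Rightarrow> complex" where
  "act \<gamma> = moebius (of_int (\<gamma>$1$1)) (of_int (\<gamma>$1$2)) (of_int (\<gamma>$2$1)) (of_int (\<gamma>$2$2))"


section \<open>The double cover of \<open>GL\<^sub>2(\<int>)\<close>\<close>

definition chi :: "mat2 \<Rightarrow> int" where
  "chi \<gamma> = (if \<gamma>$2$1 \<noteq> 0 then \<gamma>$2$1 else \<gamma>$2$2)"

definition hilbert_symbol :: "real \<Rightarrow> real \<Rightarrow> int" where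
  "hilbert_symbol a b = (if a < 0 \<and> b < 0 then -1 else 1)"

definition A_cocycle :: "mat2 \<Rightarrow> mat2 \<Rightarrow> int" where
  "A_cocycle \<alpha> \<beta> =
     hilbert_symbol (of_int (det \<alpha>)) (of_int (det \<beta>)) *
     hilbert_symbol (of_int (chi (\<alpha> ** \<beta>)) / of_int (chi \<alpha>))
                    (of_int (chi (\<alpha> ** \<beta>)) / (of_int (chi \<beta>) * of_int (det \<alpha>)))"

definition B_sign :: "mat2 \<Rightarrow> int" where
  "B_sign \<gamma> = hilbert_symbol (of_int (chi \<gamma>)) (of_int (chi (\<gamma> ** R_mat)))"

definition GL2t :: "(mat2 \<times> int) monoid" where
  "GL2t = \<lparr>carrier = GL2Z \<times> {1, -1},
           mult = (\<lambda>(\<alpha>, \<epsilon>) (\<beta>, \<delta>). (\<alpha> ** \<beta>, A_cocycle \<alpha> \<beta> * \<epsilon> * \<delta>)),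
           one = (mat 1, 1)\<rparr>"

definition R_tilde :: "mat2 \<times> int" where "R_tilde = (R_mat, 1)"


section \<open>The metaplectic group and its embedding\<close>

definition Mp2 :: "(mat2 \<times> (complex \<Rightarrow> complex)) monoid" where
  "Mp2 = \<lparr>carrier = {(\<gamma>, \<phi>). \<gamma> \<in> SL2Z \<and> \<phi> \<in> funs_on Hplus \<and> \<phi> holomorphic_on Hplus \<and>
                     (\<forall>z\<in>Hplus. (\<phi> z)\<^sup>2 = of_int (\<gamma>$2$1) * z + of_int (\<gamma>$2$2))},
          mult = (\<lambda>(\<alpha>, \<phi>) (\<beta>, \<psi>).
                    (\<alpha> ** \<beta>, \<lambda>z. if z \<in> Hplus then \<phi> (act \<beta> z) * \<psi> z else 0)),
          one = (mat 1, \<lambda>z. if z \<in> Hplus then 1 else 0)\<rparr>"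

text \<open>The admissible embeddings of the metaplectic group into \<^term>\<open>GL2t\<close>. There are
  two of them (they differ by the nontrivial sign character of \<open>SL\<^sub>2(\<int>)\<close>).\<close>

definition lifting_embedding ::
    "(mat2 \<times> (complex \<Rightarrow> complex) \<Rightarrow> mat2 \<times> int) \<Rightarrow> bool" where
  "lifting_embedding \<iota> \<longleftrightarrow> \<iota> \<in> mon Mp2 GL2t \<and> (\<forall>x\<in>carrier Mp2. fst (\<iota> x) = fst x)"

text \<open>The metaplectic group, identified with its image in \<^term>\<open>GL2t\<close>.\<close>

definition SL2t :: "(mat2 \<times> (complex \<Rightarrow> complex) \<Rightarrow> mat2 \<times> int) \<Rightarrow> (mat2 \<times> int) monoid" where
  "SL2t \<iota> = GL2t\<lparr>carrier := \<iota> ` carrier Mp2\<rparr>"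

definition phi_plus ::
    "(mat2 \<times> (complex \<Rightarrow> complex) \<Rightarrow> mat2 \<times> int) \<Rightarrow> mat2 \<Rightarrow> complex \<Rightarrow> complex" where
  "phi_plus \<iota> \<gamma> = (THE \<phi>. (\<gamma>, \<phi>) \<in> carrier Mp2 \<and> \<iota> (\<gamma>, \<phi>) = (\<gamma>, 1))"


section \<open>Vector spaces, representations and holomorphic vector-valued functions\<close>

text \<open>A complex vector space is a type \<^typ>\<open>'v::ab_group_add\<close> with a scalar multiplication
  \<open>s\<close> satisfying \<^term>\<open>vector_space (s :: complex \<Rightarrow> 'v \<Rightarrow> 'v::ab_group_add)\<close>.\<close>

definition pair_scale ::
    "(complex \<Rightarrow> 'v \<Rightarrow> 'v) \<Rightarrow> complex \<Rightarrow> 'v \<times> 'v \<Rightarrow> 'v \<times> 'v::ab_group_add" where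
  "pair_scale s = module_prod.scale s s"

definition fun_scale ::
    "(complex \<Rightarrow> 'v \<Rightarrow> 'v) \<Rightarrow> complex \<Rightarrow> (complex \<Rightarrow> 'v) \<Rightarrow> (complex \<Rightarrow> 'v)" where
  "fun_scale s c f = (\<lambda>z. s c (f z))"

definition GL_group :: "(complex \<Rightarrow> 'v \<Rightarrow> 'v) \<Rightarrow> ('v::ab_group_add \<Rightarrow> 'v) monoid" where
  "GL_group s = \<lparr>carrier = {T. Vector_Spaces.linear s s T \<and> bij T}, mult = (\<circ>), one = id\<rparr>"

definition holomorphic_vec ::
    "(complex \<Rightarrow> 'v \<Rightarrow> 'v) \<Rightarrow> complex set \<Rightarrow> (complex \<Rightarrow> 'v::ab_group_add) \<Rightarrow> bool" where
  "holomorphic_vec s S f \<longleftrightarrow>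
     (\<forall>l :: 'v \<Rightarrow> complex. Vector_Spaces.linear s (*) l \<longrightarrow> (l \<circ> f) holomorphic_on S)"

text \<open>\<open>h\<close> restricts to an isomorphism from the subspace \<open>S\<close> onto the subspace \<open>T\<close>.\<close>

definition subspace_iso ::
    "(complex \<Rightarrow> 'a \<Rightarrow> 'a) \<Rightarrow> (complex \<Rightarrow> 'b \<Rightarrow> 'b) \<Rightarrow> 'a::ab_group_add set
       \<Rightarrow> 'b::ab_group_add set \<Rightarrow> ('a \<Rightarrow> 'b) \<Rightarrow> bool" where
  "subspace_iso s t S T h \<longleftrightarrow>
     module.subspace s S \<and> module.subspace t T \<and>
     (\<forall>x\<in>S. \<forall>y\<in>S. h (x + y) = h x + h y) \<and> (\<forall>c. \<forall>x\<in>S. h (s c x) = t c (h x)) \<and>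
     bij_betw h S T"


section \<open>Weight \<open>k\<close> action and modular forms\<close>

text \<open>For a half-integral weight \<open>k\<close> this is the integer \<open>2k\<close>.\<close>

definition twice :: "real \<Rightarrow> int" where "twice k = \<lfloor>2 * k\<rfloor>"

text \<open>The two actions below are meaningful only at points \<open>z\<close> of \<^term>\<open>Hstar\<close> and of
  \<^term>\<open>Hplus\<close>, respectively.\<close>

definition slash_GL ::
    "(mat2 \<times> (complex \<Rightarrow> complex) \<Rightarrow> mat2 \<times> int) \<Rightarrow> (complex \<Rightarrow> 'v \<Rightarrow> 'v) \<Rightarrow> real
       \<Rightarrow> (complex \<Rightarrow> 'v) \<Rightarrow> mat2 \<times> int \<Rightarrow> complex \<Rightarrow> 'v" where
  "slash_GL \<iota> s k f = (\<lambda>(\<gamma>, \<epsilon>) z.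
     s ((if det \<gamma> = 1 then
           if z \<in> Hplus then of_int \<epsilon> * phi_plus \<iota> \<gamma> z
           else of_int \<epsilon> * of_int (B_sign \<gamma>) * phi_plus \<iota> (R_mat ** \<gamma> ** R_mat) (- z)
         else
           if z \<in> Hplus then
             \<i> * of_int \<epsilon> * of_int (A_cocycle R_mat \<gamma>) * phi_plus \<iota> (R_mat ** \<gamma>) z
           else
             \<i> * of_int \<epsilon> * of_int (A_cocycle R_mat \<gamma>) * of_int (B_sign (R_mat ** \<gamma>)) *
             phi_plus \<iota> (\<gamma> ** R_mat) (- z)) powi (- twice k))
       (f (act \<gamma> z)))"

definition slash_SL ::
    "(mat2 \<times> (complex \<Rightarrow> complex) \<Rightarrow> mat2 \<times> int) \<Rightarrow> (complex \<Rightarrow> 'v \<Rightarrow> 'v) \<Rightarrow> real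
       \<Rightarrow> (complex \<Rightarrow> 'v) \<Rightarrow> mat2 \<times> int \<Rightarrow> complex \<Rightarrow> 'v" where
  "slash_SL \<iota> s k f = (\<lambda>(\<gamma>, \<epsilon>) z.
     s ((of_int \<epsilon> * phi_plus \<iota> \<gamma> z) powi (- twice k)) (f (act \<gamma> z)))"

definition M_GL ::
    "(mat2 \<times> (complex \<Rightarrow> complex) \<Rightarrow> mat2 \<times> int) \<Rightarrow> (complex \<Rightarrow> 'v \<Rightarrow> 'v) \<Rightarrow> real
       \<Rightarrow> (mat2 \<times> int \<Rightarrow> 'v \<Rightarrow> 'v) \<Rightarrow> (complex \<Rightarrow> 'v::ab_group_add) set" where
  "M_GL \<iota> s k \<rho> = {f \<in> funs_on Hstar. holomorphic_vec s Hstar f \<and>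
     (\<forall>x\<in>carrier GL2t. \<forall>z\<in>Hstar. slash_GL \<iota> s k f x z = \<rho> x (f z))}"

definition M_SL ::
    "(mat2 \<times> (complex \<Rightarrow> complex) \<Rightarrow> mat2 \<times> int) \<Rightarrow> (complex \<Rightarrow> 'v \<Rightarrow> 'v) \<Rightarrow> real
       \<Rightarrow> (mat2 \<times> int \<Rightarrow> 'v \<Rightarrow> 'v) \<Rightarrow> (complex \<Rightarrow> 'v::ab_group_add) set" where
  "M_SL \<iota> s k \<rho> = {f \<in> funs_on Hplus. holomorphic_vec s Hplus f \<and>
     (\<forall>x\<in>carrier (SL2t \<iota>). \<forall>z\<in>Hplus. slash_SL \<iota> s k f x z = \<rho> x (f z))}"


section \<open>Induction\<close>

definition rep_R :: "(mat2 \<times> int \<Rightarrow> 'v \<Rightarrow> 'v) \<Rightarrow> mat2 \<times> int \<Rightarrow> 'v \<Rightarrow> 'v" where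
  "rep_R \<rho> x = \<rho> (R_tilde \<otimes>\<^bsub>GL2t\<^esub> x \<otimes>\<^bsub>GL2t\<^esub> inv\<^bsub>GL2t\<^esub> R_tilde)"

text \<open>Elements outside the index-two subgroup \<^term>\<open>SL2t \<iota>\<close> are written as
  \<^term>\<open>R_tilde\<close> times an element of it.\<close>

definition Ind_rep ::
    "(mat2 \<times> (complex \<Rightarrow> complex) \<Rightarrow> mat2 \<times> int) \<Rightarrow> (mat2 \<times> int \<Rightarrow> 'v \<Rightarrow> 'v)
       \<Rightarrow> mat2 \<times> int \<Rightarrow> 'v \<times> 'v \<Rightarrow> 'v \<times> 'v" where
  "Ind_rep \<iota> \<rho> x =
     (if x \<in> carrier (SL2t \<iota>) then (\<lambda>(v, w). (\<rho> x v, rep_R \<rho> x w))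
      else let y = inv\<^bsub>GL2t\<^esub> R_tilde \<otimes>\<^bsub>GL2t\<^esub> x
           in (\<lambda>(v, w). (rep_R \<rho> y w, \<rho> (mat 1, -1) (\<rho> y v))))"

definition Ind_map ::
    "(complex \<Rightarrow> 'v \<Rightarrow> 'v) \<Rightarrow> real \<Rightarrow> (complex \<Rightarrow> 'v) \<times> (complex \<Rightarrow> 'v)
       \<Rightarrow> complex \<Rightarrow> 'v \<times> 'v::ab_group_add" where
  "Ind_map s k = (\<lambda>(f, g) z.
     if z \<in> Hplus then (f z, g z)
     else if z \<in> Hminus then (s ((- \<i>) powi twice k) (g (- z)), s (\<i> powi twice k) (f (- z)))
     else 0)"

end

theory Submission
  imports Defs
begin

text \<open>
  The group \<open>GL\<^sub>2(\<int>)\<close> is generated by \<open>SL\<^sub>2(\<int>)\<close> and the reflection \<open>R\<close>, and \<open>R\<close> exchanges the two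
  half-planes by \<open>z \<mapsto> - z\<close>. A form \<open>F\<close> for the big group is therefore determined by its restriction
  to the upper half-plane: the transformation law for the lift of \<open>R\<close>, whose automorphy factor is
  the constant \<open>- \<i>\<close>, computes \<open>F (- z)\<close> from \<open>F z\<close> (\<open>M_GL_Hminus\<close>). For the representation
  \<open>Ind \<rho>\<close> this computation gives precisely the formula that defines \<open>Ind_map\<close> on the lower
  half-plane. The two components of the restriction satisfy the laws for \<open>\<rho>\<close> and its conjugate
  \<open>\<rho>\<^sup>R\<close>, because \<open>Ind \<rho>\<close> is diagonal on the subgroup of determinant one (\<open>M_GL_restrict\<close>). Thus
  restriction is the inverse of induction (\<open>bij_betw_Ind_map\<close>), once it is known that an induced
  pair does satisfy all the transformation laws.

  That last point (\<open>slash_Ind_map\<close>) is a comparison of signs. Conjugation by the lift of \<open>R\<close> sends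
  \<open>[\<gamma>, \<epsilon>]\<close> to \<open>[R\<gamma>R, \<epsilon> B(\<gamma>)]\<close> for \<open>\<gamma>\<close> of determinant one (\<open>R_tilde_conj\<close>, from the evaluation of
  the cocycle in \<open>A_cocycle_conj_R\<close>), which are exactly the matrix and the sign in the weight \<open>k\<close>
  action on the lower half-plane. So there the law for \<open>Ind(f, g)\<close> is the law for \<open>f\<close> and \<open>g\<close> at
  the conjugated element and the point \<open>- z\<close>. For determinant \<open>-1\<close> the powers of \<open>\<i>\<close> that remain
  differ at most by \<open>(-1)\<^sup>2\<^sup>k\<close>, and the element \<open>[I, -1]\<close> in the lower left entry of \<open>Ind \<rho>\<close>
  contributes this factor, because changing the sign of \<open>\<epsilon>\<close> multiplies the automorphy factor
  by it (\<open>M_SL_sign\<close>).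

  The embedding \<open>\<iota>\<close> enters through two consequences that hold for either choice of it: its image is
  the set of all pairs \<open>[\<gamma>, \<epsilon>]\<close> with determinant one (\<open>SL2t_carrier\<close>), and the automorphy factor of
  \<open>[I, 1]\<close> is \<open>1\<close> (\<open>phi_plus_one\<close>).
\<close>

section \<open>Matrices of determinant plus or minus one and the reflection\<close>

lemma mat2_mult:
  fixes A B :: mat2
  shows "(A ** B) $ i $ j = A $ i $ 1 * B $ 1 $ j + A $ i $ 2 * B $ 2 $ j"
  by (simp add: matrix_matrix_mult_def sum_2)

lemma mat2_eqI:
  fixes A B :: mat2
  assumes "A$1$1 = B$1$1" "A$1$2 = B$1$2" "A$2$1 = B$2$1" "A$2$2 = B$2$2"
  shows "A = B"
  using assms by (simp add: vec_eq_iff forall_2)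

lemma mat2_one: "(mat 1 :: mat2)$1$1 = 1" "(mat 1 :: mat2)$1$2 = 0"
  "(mat 1 :: mat2)$2$1 = 0" "(mat 1 :: mat2)$2$2 = 1"
  by (simp_all add: mat_def)

lemma R_mat_entries: "R_mat$1$1 = -1" "R_mat$1$2 = 0" "R_mat$2$1 = 0" "R_mat$2$2 = 1"
  by (simp_all add: R_mat_def)

lemma R_mat_square: "R_mat ** R_mat = mat 1"
  by (rule mat2_eqI) (simp_all add: mat2_mult R_mat_entries mat2_one)

lemma R_mat_cancel: "R_mat ** (R_mat ** \<gamma>) = \<gamma>"
  by (simp add: matrix_mul_assoc R_mat_square)

lemma R_mat_cancel_right: "\<gamma> ** R_mat ** R_mat = \<gamma>"
  by (simp flip: matrix_mul_assoc add: R_mat_square)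

lemma det_R_mat: "det R_mat = -1"
  by (simp add: det_2 R_mat_entries)

lemma R_mat_GL2Z: "R_mat \<in> GL2Z"
  unfolding GL2Z_def invertible_def using R_mat_square by blast

lemma GL2Z_det_cases:
  assumes "\<gamma> \<in> GL2Z"
  obtains "det \<gamma> = 1" | "det \<gamma> = -1"
proof -
  obtain \<delta> where "\<gamma> ** \<delta> = mat 1"
    using assms by (auto simp: GL2Z_def invertible_def)
  then have "det \<gamma> * det \<delta> = 1"
    by (metis det_I det_mul)
  then show ?thesis
    using that by (auto simp: zmult_eq_1_iff)
qed

lemma SL2Z_conj_R: "\<gamma> \<in> SL2Z \<Longrightarrow> R_mat ** \<gamma> ** R_mat \<in> SL2Z"
  by (simp add: SL2Z_def det_mul det_R_mat)

lemma chi_R_left: "chi (R_mat ** \<gamma>) = chi \<gamma>"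
  by (simp add: chi_def mat2_mult R_mat_entries)

lemma chi_R_right: "chi (\<gamma> ** R_mat) = (if \<gamma>$2$1 = 0 then chi \<gamma> else - chi \<gamma>)"
  by (simp add: chi_def mat2_mult R_mat_entries)

lemma chi_nonzero:
  assumes "\<gamma> \<in> SL2Z"
  shows "chi \<gamma> \<noteq> 0"
  using assms by (auto simp: chi_def SL2Z_def det_2)


section \<open>Moebius transformations\<close>

lemma act_eq:
  "act \<gamma> z = (of_int (\<gamma>$1$1) * z + of_int (\<gamma>$1$2)) / (of_int (\<gamma>$2$1) * z + of_int (\<gamma>$2$2))"
  by (simp add: act_def moebius_def)

lemma act_one: "act (mat 1) z = z"
  by (simp add: act_eq mat2_one)

lemma act_R_left: "act (R_mat ** \<gamma>) z = - act \<gamma> z"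
  by (simp add: act_eq mat2_mult R_mat_entries minus_divide_left)

lemma act_R_right: "act (\<gamma> ** R_mat) z = act \<gamma> (- z)"
  by (simp add: act_eq mat2_mult R_mat_entries)

lemma Hplus_uminus_iff: "- z \<in> Hplus \<longleftrightarrow> z \<in> Hminus"
  and Hminus_uminus_iff: "- z \<in> Hminus \<longleftrightarrow> z \<in> Hplus"
  by (simp_all add: Hplus_def Hminus_def)

lemma Hminus_not_Hplus: "z \<in> Hminus \<Longrightarrow> z \<notin> Hplus"
  by (simp add: Hplus_def Hminus_def)

text \<open>Expanding a fraction by the conjugate of its denominator makes the denominator real, so that the
  sign of the imaginary part of a Moebius transform is read off from this numerator.\<close>

lemma Im_moebius_numerator:
  fixes z :: complex and a b c d :: real
  shows "Im ((of_real a * z + of_real b) * cnj (of_real c * z + of_real d)) = (a * d - b * c) * Im z"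
  by (simp add: algebra_simps)

lemma act_Hplus:
  assumes "\<gamma> \<in> SL2Z" "z \<in> Hplus"
  shows "act \<gamma> z \<in> Hplus"
proof -
  define w where "w = of_int (\<gamma>$2$1) * z + of_int (\<gamma>$2$2)"
  have det: "\<gamma>$1$1 * \<gamma>$2$2 - \<gamma>$1$2 * \<gamma>$2$1 = 1"
    using assms by (simp add: SL2Z_def det_2)
  have "w \<noteq> 0"
  proof
    assume "w = 0"
    then have "Im w = 0" "Re w = 0"
      by simp_all
    then have "\<gamma>$2$1 = 0" "\<gamma>$2$2 = 0"
      using assms(2) by (auto simp: w_def Hplus_def)
    then show False
      using det by simp
  qed
  have "(of_int (\<gamma>$1$1) * of_int (\<gamma>$2$2) - of_int (\<gamma>$1$2) * of_int (\<gamma>$2$1) :: real) = 1"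
    using det by (simp flip: of_int_mult of_int_diff)
  then have "Im ((of_int (\<gamma>$1$1) * z + of_int (\<gamma>$1$2)) * cnj w) = Im z"
    using Im_moebius_numerator[of "of_int (\<gamma>$1$1)" z "of_int (\<gamma>$1$2)" "of_int (\<gamma>$2$1)"
        "of_int (\<gamma>$2$2)"]
    by (simp add: w_def)
  then have "Im (act \<gamma> z) = Im z / (cmod w)\<^sup>2"
    by (simp add: act_eq complex_div_cnj[of _ w] flip: w_def)
  then show ?thesis
    using assms(2) \<open>w \<noteq> 0\<close> by (simp add: Hplus_def)
qed


section \<open>The double covers\<close>

lemma GL2t_mult: "(\<alpha>, \<epsilon>) \<otimes>\<^bsub>GL2t\<^esub> (\<beta>, \<delta>) = (\<alpha> ** \<beta>, A_cocycle \<alpha> \<beta> * \<epsilon> * \<delta>)"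
  by (simp add: GL2t_def)

lemma GL2t_carrier: "carrier GL2t = GL2Z \<times> {1, -1}"
  by (simp add: GL2t_def)

lemma A_cocycle_sign: "A_cocycle \<alpha> \<beta> \<in> {1, -1}"
  by (simp add: A_cocycle_def hilbert_symbol_def)

lemma B_sign_sign: "B_sign \<gamma> \<in> {1, -1}"
  by (simp add: B_sign_def hilbert_symbol_def)

lemma A_cocycle_one_left:
  assumes "\<gamma> \<in> SL2Z"
  shows "A_cocycle (mat 1) \<gamma> = 1"
  using chi_nonzero[OF assms] by (simp add: A_cocycle_def hilbert_symbol_def)

lemma A_cocycle_R_R: "A_cocycle R_mat R_mat = -1"
  by (simp add: A_cocycle_def R_mat_square det_R_mat hilbert_symbol_def chi_def mat2_one
      R_mat_entries)

lemma R_tilde_carrier: "R_tilde \<in> carrier GL2t"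
  by (simp add: R_tilde_def GL2t_carrier R_mat_GL2Z)

text \<open>The sign is forced by \<open>A_cocycle_R_R\<close>: the lift of \<open>R\<close> squares to \<open>[I, -1]\<close>. Uniqueness of the
  right inverse can be read off from the two components.\<close>

lemma inv_R_tilde: "inv\<^bsub>GL2t\<^esub> R_tilde = (R_mat, -1)"
proof -
  have one: "\<one>\<^bsub>GL2t\<^esub> = (mat 1, 1)"
    by (simp add: GL2t_def)
  have unique: "y = (R_mat, -1)" if "R_tilde \<otimes>\<^bsub>GL2t\<^esub> y = \<one>\<^bsub>GL2t\<^esub>" for y
  proof -
    obtain \<beta> \<delta> where y: "y = (\<beta>, \<delta>)"
      by (cases y)
    have "R_mat ** \<beta> = mat 1" and \<delta>: "A_cocycle R_mat \<beta> * \<delta> = 1"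
      using that by (simp_all add: y one R_tilde_def GL2t_mult)
    then have "\<beta> = R_mat"
      by (metis R_mat_cancel matrix_mul_rid)
    with \<delta> show ?thesis
      by (simp add: y A_cocycle_R_R)
  qed
  show ?thesis
    unfolding m_inv_def
  proof (rule the_equality)
    show "(R_mat, -1) \<in> carrier GL2t \<and> R_tilde \<otimes>\<^bsub>GL2t\<^esub> (R_mat, -1) = \<one>\<^bsub>GL2t\<^esub> \<and>
        (R_mat, -1) \<otimes>\<^bsub>GL2t\<^esub> R_tilde = \<one>\<^bsub>GL2t\<^esub>"
      by (simp add: one R_tilde_def GL2t_mult GL2t_carrier R_mat_GL2Z R_mat_square A_cocycle_R_R)
  qed (use unique in blast)
qed

text \<open>Left multiplication by \<open>R\<close> keeps \<open>chi\<close>; right multiplication changes its sign exactly when the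
  lower left entry is nonzero. If that entry is \<open>c \<noteq> 0\<close>, both cocycle values are governed by the
  sign of \<open>c\<close>, and \<open>(c, -c) = 1\<close>; if \<open>c = 0\<close>, everything reduces to the sign of the entry \<open>d\<close>.\<close>

lemma A_cocycle_conj_R:
  assumes "\<gamma> \<in> SL2Z"
  shows "A_cocycle (R_mat ** \<gamma>) R_mat * A_cocycle R_mat \<gamma> = - B_sign \<gamma>"
proof -
  have "det \<gamma> = 1"
    using assms by (simp add: SL2Z_def)
  moreover have "chi R_mat = 1"
    by (simp add: chi_def R_mat_entries)
  ultimately show ?thesis
    using chi_nonzero[OF assms]
    by (auto simp: A_cocycle_def B_sign_def hilbert_symbol_def det_mul det_R_mat chi_R_left
        chi_R_right mat2_mult R_mat_entries simp flip: matrix_mul_assoc)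
qed

text \<open>The sign \<open>B\<close> measures how far the obvious section \<open>\<gamma> \<mapsto> [\<gamma>, 1]\<close> is from commuting with
  conjugation by \<open>R\<close>.\<close>

lemma R_tilde_conj:
  assumes "\<gamma> \<in> SL2Z"
  shows "R_tilde \<otimes>\<^bsub>GL2t\<^esub> (\<gamma>, \<epsilon>) \<otimes>\<^bsub>GL2t\<^esub> inv\<^bsub>GL2t\<^esub> R_tilde = (R_mat ** \<gamma> ** R_mat, \<epsilon> * B_sign \<gamma>)"
proof -
  have "A_cocycle (R_mat ** \<gamma>) R_mat * (A_cocycle R_mat \<gamma> * 1 * \<epsilon>) * (-1)
      = - (A_cocycle (R_mat ** \<gamma>) R_mat * A_cocycle R_mat \<gamma>) * \<epsilon>"
    by simp
  also have "\<dots> = \<epsilon> * B_sign \<gamma>"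
    unfolding A_cocycle_conj_R[OF assms] by simp
  finally show ?thesis
    unfolding inv_R_tilde unfolding R_tilde_def GL2t_mult by simp
qed

lemma rep_R_eq:
  assumes "\<gamma> \<in> SL2Z"
  shows "rep_R \<rho> (\<gamma>, \<epsilon>) = \<rho> (R_mat ** \<gamma> ** R_mat, \<epsilon> * B_sign \<gamma>)"
  by (simp add: rep_R_def R_tilde_conj[OF assms])

lemma B_sign_conj_R: "B_sign (R_mat ** \<gamma> ** R_mat) = B_sign \<gamma>"
proof -
  have "chi (R_mat ** \<gamma> ** R_mat) = chi (\<gamma> ** R_mat)"
    by (metis chi_R_left matrix_mul_assoc)
  moreover have "chi (R_mat ** \<gamma> ** R_mat ** R_mat) = chi \<gamma>"
    by (simp only: R_mat_cancel_right chi_R_left)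
  ultimately show ?thesis
    by (simp add: B_sign_def hilbert_symbol_def)
qed

text \<open>Conjugating twice by the lift of \<open>R\<close> is conjugation by the central element \<open>[I, -1]\<close>, hence
  trivial: passing to the conjugate representation is an involution.\<close>

lemma rep_R_conj_R:
  assumes "\<gamma> \<in> SL2Z"
  shows "rep_R \<rho> (R_mat ** \<gamma> ** R_mat, \<epsilon> * B_sign \<gamma>) = \<rho> (\<gamma>, \<epsilon>)"
proof -
  have "R_mat ** (R_mat ** \<gamma> ** R_mat) ** R_mat = \<gamma>"
    by (metis R_mat_cancel R_mat_cancel_right matrix_mul_assoc)
  moreover have "\<epsilon> * B_sign \<gamma> * B_sign \<gamma> = \<epsilon>"
    using B_sign_sign[of \<gamma>] by auto
  ultimately show ?thesis
    by (simp only: rep_R_eq[OF SL2Z_conj_R[OF assms]] B_sign_conj_R)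
qed

text \<open>The principal square root of \<open>cz + d\<close> is holomorphic on the upper half-plane, as \<open>cz + d\<close> is
  constant or stays off the real axis.\<close>

lemma Mp2_exists:
  assumes "\<gamma> \<in> SL2Z"
  shows "\<exists>\<phi>. (\<gamma>, \<phi>) \<in> carrier Mp2 \<and> (\<gamma>, - \<phi>) \<in> carrier Mp2 \<and> \<phi> \<noteq> - \<phi>"
proof -
  define w where "w z = of_int (\<gamma>$2$1) * z + of_int (\<gamma>$2$2)" for z :: complex
  define \<phi> where "\<phi> z = (if z \<in> Hplus then csqrt (w z) else 0)" for z
  have c: "\<gamma>$2$2 \<noteq> 0" if "\<gamma>$2$1 = 0"
    using assms that by (auto simp: SL2Z_def det_2)
  have "(\<lambda>z. csqrt (w z)) holomorphic_on Hplus"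
  proof (cases "\<gamma>$2$1 = 0")
    case True
    then show ?thesis
      by (simp add: w_def)
  next
    case False
    have "w z \<notin> \<real>\<^sub>\<le>\<^sub>0" if "z \<in> Hplus" for z
      using False that by (auto simp: w_def Hplus_def complex_nonpos_Reals_iff)
    moreover have "w holomorphic_on Hplus"
      unfolding w_def by (intro holomorphic_intros)
    ultimately show ?thesis
      by (auto intro!: holomorphic_on_csqrt')
  qed
  then have hol: "\<phi> holomorphic_on Hplus"
    by (rule holomorphic_transform) (simp add: \<phi>_def)
  then have "(\<lambda>z. - \<phi> z) holomorphic_on Hplus"
    by (rule holomorphic_on_minus)
  then have hol': "(- \<phi>) holomorphic_on Hplus"
    by (simp add: fun_Compl_def)
  have "\<i> \<in> Hplus"
    by (simp add: Hplus_def)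
  moreover have "w \<i> \<noteq> 0"
    using c by (auto simp: w_def complex_eq_iff)
  ultimately have "\<phi> \<i> \<noteq> (- \<phi>) \<i>"
    by (simp add: \<phi>_def eq_neg_iff_add_eq_0 flip: mult_2)
  then have "\<phi> \<noteq> - \<phi>"
    by metis
  moreover have "\<phi> \<in> funs_on Hplus" "- \<phi> \<in> funs_on Hplus"
    by (simp_all add: funs_on_def \<phi>_def)
  moreover have "(\<phi> z)\<^sup>2 = w z" "((- \<phi>) z)\<^sup>2 = w z" if "z \<in> Hplus" for z
    using that by (simp_all add: \<phi>_def)
  ultimately show ?thesis
    using hol hol' assms by (auto simp: Mp2_def w_def)
qed

text \<open>The two square roots of \<open>cz + d\<close> give two elements over \<open>\<gamma>\<close>; an injective lift must map them to
  the only two candidates \<open>[\<gamma>, 1]\<close> and \<open>[\<gamma>, -1]\<close>.\<close>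

lemma SL2t_carrier:
  assumes "lifting_embedding \<iota>"
  shows "carrier (SL2t \<iota>) = SL2Z \<times> {1, -1}"
proof -
  have \<iota>: "\<iota> \<in> mon Mp2 GL2t" "\<And>x. x \<in> carrier Mp2 \<Longrightarrow> fst (\<iota> x) = fst x"
    using assms by (auto simp: lifting_embedding_def)
  then have inj: "inj_on \<iota> (carrier Mp2)"
    and range: "\<And>x. x \<in> carrier Mp2 \<Longrightarrow> \<iota> x \<in> carrier GL2t"
    by (auto simp: mon_def hom_def)
  have form: "\<iota> (\<gamma>, \<phi>) \<in> {(\<gamma>, 1), (\<gamma>, -1)}" if "(\<gamma>, \<phi>) \<in> carrier Mp2" for \<gamma> \<phi>
    using range[OF that] \<iota>(2)[OF that] by (cases "\<iota> (\<gamma>, \<phi>)") (auto simp: GL2t_carrier)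
  have "\<iota> ` carrier Mp2 = SL2Z \<times> {1, -1}"
  proof
    have "fst x \<in> SL2Z" if "x \<in> carrier Mp2" for x
      using that by (auto simp: Mp2_def)
    then show "\<iota> ` carrier Mp2 \<subseteq> SL2Z \<times> {1, -1}"
      using form by fastforce
    show "SL2Z \<times> {1, -1} \<subseteq> \<iota> ` carrier Mp2"
    proof clarify
      fix \<gamma> and \<epsilon> :: int
      assume \<gamma>: "\<gamma> \<in> SL2Z" and \<epsilon>: "\<epsilon> \<in> {1, -1}"
      obtain \<phi> where \<phi>: "(\<gamma>, \<phi>) \<in> carrier Mp2" "(\<gamma>, - \<phi>) \<in> carrier Mp2" "\<phi> \<noteq> - \<phi>"
        using Mp2_exists[OF \<gamma>] by blast
      then have "\<iota> (\<gamma>, \<phi>) \<noteq> \<iota> (\<gamma>, - \<phi>)"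
        using inj by (auto dest: inj_onD)
      then have "(\<gamma>, \<epsilon>) = \<iota> (\<gamma>, \<phi>) \<or> (\<gamma>, \<epsilon>) = \<iota> (\<gamma>, - \<phi>)"
        using form[OF \<phi>(1)] form[OF \<phi>(2)] \<epsilon> by auto
      then show "(\<gamma>, \<epsilon>) \<in> \<iota> ` carrier Mp2"
        using \<phi> by blast
    qed
  qed
  then show ?thesis
    by (simp add: SL2t_def)
qed

lemma phi_plus_one:
  assumes "lifting_embedding \<iota>" "z \<in> Hplus"
  shows "phi_plus \<iota> (mat 1) z = 1"
proof -
  define e :: "mat2 \<times> (complex \<Rightarrow> complex)" where "e = \<one>\<^bsub>Mp2\<^esub>"
  have e_eq: "e = (mat 1, \<lambda>z. if z \<in> Hplus then 1 else 0)"
    by (simp add: e_def Mp2_def)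
  have "(\<lambda>z. if z \<in> Hplus then 1 else 0 :: complex) holomorphic_on Hplus"
    by (rule holomorphic_transform[OF holomorphic_on_const[of 1]]) simp
  then have e: "e \<in> carrier Mp2"
    by (simp add: e_eq Mp2_def SL2Z_def funs_on_def mat2_one)
  \<comment> \<open>The image of the idempotent \<open>e\<close> is idempotent, and \<open>[I, -1]\<close> is not.\<close>
  have "e \<otimes>\<^bsub>Mp2\<^esub> e = e"
    by (auto simp: e_eq Mp2_def act_one)
  moreover have hom: "\<iota> \<in> hom Mp2 GL2t" and inj: "inj_on \<iota> (carrier Mp2)"
    using assms by (auto simp: lifting_embedding_def mon_def)
  ultimately have idem: "\<iota> e \<otimes>\<^bsub>GL2t\<^esub> \<iota> e = \<iota> e"
    by (metis hom_mult e)
  obtain \<epsilon> where \<epsilon>: "\<iota> e = (mat 1, \<epsilon>)"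
    using assms(1) e by (cases "\<iota> e") (auto simp: lifting_embedding_def e_eq)
  moreover have "\<iota> e \<in> carrier GL2t"
    using hom e by (auto simp: hom_def)
  ultimately have "\<epsilon> = 1"
    using idem A_cocycle_one_left[of "mat 1"] by (auto simp: GL2t_mult GL2t_carrier SL2Z_def)
  then have image: "\<iota> e = (mat 1, 1)"
    using \<epsilon> by simp
  have "phi_plus \<iota> (mat 1) = snd e"
    unfolding phi_plus_def
  proof (rule the_equality)
    show "(mat 1, snd e) \<in> carrier Mp2 \<and> \<iota> (mat 1, snd e) = (mat 1, 1)"
      using e image by (simp add: e_eq)
    show "\<phi> = snd e" if "(mat 1, \<phi>) \<in> carrier Mp2 \<and> \<iota> (mat 1, \<phi>) = (mat 1, 1)" for \<phi>
      using inj_onD[OF inj, of "(mat 1, \<phi>)" e] that e image by auto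
  qed
  then show ?thesis
    using assms by (simp add: e_eq)
qed


section \<open>Spaces of vector-valued functions\<close>

lemma pair_scale_eq:
  assumes "vector_space s"
  shows "pair_scale s c p = (s c (fst p), s c (snd p))"
proof -
  interpret vector_space s by fact
  have "module_prod s s"
    by (simp add: module_prod_def module_pair_def module_axioms)
  then show ?thesis
    by (simp add: pair_scale_def module_prod.scale_def)
qed

lemma vector_space_pair_scale:
  assumes "vector_space s"
  shows "vector_space (pair_scale s)"
proof -
  interpret vector_space s by fact
  show ?thesis
    by unfold_locales
      (auto simp: pair_scale_eq[OF assms] scale_left_distrib scale_right_distrib)
qed

lemma vector_space_fun_scale:
  assumes "vector_space s"
  shows "vector_space (fun_scale s)"
proof -
  interpret vector_space s by fact
  show ?thesis
    by unfold_locales (auto simp: fun_scale_def scale_left_distrib scale_right_distrib)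
qed

lemma linear_pairD:
  assumes "vector_space s" "Vector_Spaces.linear (pair_scale s) (*) l"
  shows "Vector_Spaces.linear s (*) (\<lambda>v. l (v, 0))" "Vector_Spaces.linear s (*) (\<lambda>v. l (0, v))"
    "l (v, w) = l (v, 0) + l (0, w)"
proof -
  interpret vector_space s by fact
  interpret l: Vector_Spaces.linear "pair_scale s" "(*)" l by fact
  have add: "l (v, w) + l (v', w') = l (v + v', w + w')" for v w v' w'
    using l.add[of "(v, w)" "(v', w')"] by simp
  have mult: "c * l (v, w) = l (s c v, s c w)" for c v w
    using l.scale[of c "(v, w)"] by (simp add: pair_scale_eq[OF assms(1)])
  show "l (v, w) = l (v, 0) + l (0, w)"
    by (simp add: add)
  show "Vector_Spaces.linear s (*) (\<lambda>v. l (v, 0))" "Vector_Spaces.linear s (*) (\<lambda>v. l (0, v))"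
    by unfold_locales (simp_all add: add mult algebra_simps)
qed

lemma linear_of_component:
  assumes "vector_space s" "Vector_Spaces.linear s (*) l"
  shows "Vector_Spaces.linear (pair_scale s) (*) (\<lambda>p. l (fst p))"
    "Vector_Spaces.linear (pair_scale s) (*) (\<lambda>p. l (snd p))"
proof -
  interpret vector_space s by fact
  interpret p: vector_space "pair_scale s" by (rule vector_space_pair_scale) fact
  interpret l: Vector_Spaces.linear s "(*)" l by fact
  show "Vector_Spaces.linear (pair_scale s) (*) (\<lambda>p. l (fst p))"
    "Vector_Spaces.linear (pair_scale s) (*) (\<lambda>p. l (snd p))"
    by unfold_locales (simp_all add: pair_scale_eq[OF assms(1)] l.add l.scale)
qed

text \<open>A functional on a direct sum is the sum of its restrictions to the two summands, which allows
  holomorphy to be tested on the components.\<close>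

lemma holomorphic_vec_Pair_iff:
  assumes "vector_space s"
  shows "holomorphic_vec (pair_scale s) S F \<longleftrightarrow>
    holomorphic_vec s S (\<lambda>z. fst (F z)) \<and> holomorphic_vec s S (\<lambda>z. snd (F z))"
proof (intro iffI conjI)
  assume F: "holomorphic_vec (pair_scale s) S F"
  show "holomorphic_vec s S (\<lambda>z. fst (F z))" "holomorphic_vec s S (\<lambda>z. snd (F z))"
    using F linear_of_component[OF assms] by (auto simp: holomorphic_vec_def o_def)
next
  assume F: "holomorphic_vec s S (\<lambda>z. fst (F z)) \<and> holomorphic_vec s S (\<lambda>z. snd (F z))"
  show "holomorphic_vec (pair_scale s) S F"
    unfolding holomorphic_vec_def
  proof (intro allI impI)
    fix l :: "'a \<times> 'a \<Rightarrow> complex"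
    assume "Vector_Spaces.linear (pair_scale s) (*) l"
    note l = linear_pairD[OF assms this]
    have "(\<lambda>z. l (fst (F z), 0) + l (0, snd (F z))) holomorphic_on S"
      using F l(1,2) by (intro holomorphic_on_add) (auto simp: holomorphic_vec_def o_def)
    moreover have "l \<circ> F = (\<lambda>z. l (fst (F z), 0) + l (0, snd (F z)))"
      by (auto simp flip: l(3))
    ultimately show "(l \<circ> F) holomorphic_on S"
      by simp
  qed
qed

lemma holomorphic_vec_cong:
  assumes "\<And>z. z \<in> S \<Longrightarrow> f z = g z"
  shows "holomorphic_vec s S f \<longleftrightarrow> holomorphic_vec s S g"
proof -
  have "(l \<circ> f) holomorphic_on S \<longleftrightarrow> (l \<circ> g) holomorphic_on S" for l
    using assms by (intro holomorphic_cong) auto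
  then show ?thesis
    by (simp add: holomorphic_vec_def)
qed

lemma holomorphic_vec_subset:
  "holomorphic_vec s T f \<Longrightarrow> S \<subseteq> T \<Longrightarrow> holomorphic_vec s S f"
  by (auto simp: holomorphic_vec_def intro: holomorphic_on_subset)

lemma holomorphic_vecD:
  "holomorphic_vec s S f \<Longrightarrow> Vector_Spaces.linear s (*) l \<Longrightarrow> (\<lambda>z. l (f z)) holomorphic_on S"
  by (simp add: holomorphic_vec_def o_def)

lemma holomorphic_vecI:
  "(\<And>l. Vector_Spaces.linear s (*) l \<Longrightarrow> (\<lambda>z. l (f z)) holomorphic_on S) \<Longrightarrow> holomorphic_vec s S f"
  by (simp add: holomorphic_vec_def o_def)

lemma holomorphic_vec_Hstar:
  "holomorphic_vec s Hstar f \<longleftrightarrow> holomorphic_vec s Hplus f \<and> holomorphic_vec s Hminus f"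
proof -
  have "open Hplus" "open Hminus"
    by (simp_all add: Hplus_def Hminus_def open_halfspace_Im_gt open_halfspace_Im_lt)
  then have "holomorphic_vec s Hstar f" if "holomorphic_vec s Hplus f" "holomorphic_vec s Hminus f"
    using that unfolding holomorphic_vec_def Hstar_def by (blast intro: holomorphic_on_Un)
  then show ?thesis
    by (auto simp: Hstar_def intro: holomorphic_vec_subset)
qed

lemma holomorphic_vec_scale:
  assumes "holomorphic_vec s S f"
  shows "holomorphic_vec s S (\<lambda>z. s c (f z))"
proof (rule holomorphic_vecI)
  fix l :: "'a \<Rightarrow> complex"
  assume l: "Vector_Spaces.linear s (*) l"
  then interpret l: Vector_Spaces.linear s "(*)" l .
  show "(\<lambda>z. l (s c (f z))) holomorphic_on S"
    unfolding l.scale using holomorphic_vecD[OF assms l] by (intro holomorphic_intros)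
qed

lemma holomorphic_vec_add:
  assumes "holomorphic_vec s S f" "holomorphic_vec s S g"
  shows "holomorphic_vec s S (\<lambda>z. f z + g z)"
proof (rule holomorphic_vecI)
  fix l :: "'a \<Rightarrow> complex"
  assume l: "Vector_Spaces.linear s (*) l"
  then interpret l: Vector_Spaces.linear s "(*)" l .
  show "(\<lambda>z. l (f z + g z)) holomorphic_on S"
    unfolding l.add using assms[THEN holomorphic_vecD, OF l] by (intro holomorphic_intros)
qed

lemma holomorphic_vec_zero: "holomorphic_vec s S (\<lambda>z. 0)"
  by (auto simp: holomorphic_vec_def o_def)

lemma holomorphic_vec_reflect:
  assumes "holomorphic_vec s Hplus f"
  shows "holomorphic_vec s Hminus (\<lambda>z. f (- z))"
  unfolding holomorphic_vec_def
proof (intro allI impI)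
  fix l :: "'a \<Rightarrow> complex"
  assume "Vector_Spaces.linear s (*) l"
  then have "(l \<circ> f) holomorphic_on uminus ` Hminus"
    using assms by (auto simp: holomorphic_vec_def Hplus_def Hminus_def elim!: holomorphic_on_subset)
  then have "((l \<circ> f) \<circ> uminus) holomorphic_on Hminus"
    by (intro holomorphic_on_compose holomorphic_intros)
  then show "(l \<circ> (\<lambda>z. f (- z))) holomorphic_on Hminus"
    by (simp add: o_def)
qed

lemma subspace_M_SL:
  fixes s :: "complex \<Rightarrow> 'v \<Rightarrow> 'v::ab_group_add"
  assumes "vector_space s"
    and lin: "\<And>x. x \<in> carrier (SL2t \<iota>) \<Longrightarrow> Vector_Spaces.linear s s (\<rho> x)"
  shows "module.subspace (fun_scale s) (M_SL \<iota> s k \<rho>)"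
proof -
  interpret vector_space s by fact
  interpret fs: vector_space "fun_scale s" by (rule vector_space_fun_scale) fact
  have hom: "\<rho> x (v + w) = \<rho> x v + \<rho> x w" "\<rho> x (s c v) = s c (\<rho> x v)" "\<rho> x 0 = 0"
    if "x \<in> carrier (SL2t \<iota>)" for x c v w
  proof -
    interpret T: Vector_Spaces.linear s s "\<rho> x" by (rule lin) fact
    show "\<rho> x (v + w) = \<rho> x v + \<rho> x w" "\<rho> x (s c v) = s c (\<rho> x v)" "\<rho> x 0 = 0"
      by (simp_all add: T.add T.scale T.zero)
  qed
  have slash: "slash_SL \<iota> s k (\<lambda>z. f z + g z) x z = slash_SL \<iota> s k f x z + slash_SL \<iota> s k g x z"
    "slash_SL \<iota> s k (\<lambda>z. s c (f z)) x z = s c (slash_SL \<iota> s k f x z)"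
    "slash_SL \<iota> s k (\<lambda>z. 0) x z = 0" for f g x z c
    by (cases x; simp add: slash_SL_def scale_right_distrib mult.commute)+
  show ?thesis
    unfolding fs.subspace_def
  proof (intro conjI ballI allI)
    show "0 \<in> M_SL \<iota> s k \<rho>"
      by (simp add: M_SL_def funs_on_def slash hom holomorphic_vec_zero zero_fun_def)
  next
    fix f g
    assume "f \<in> M_SL \<iota> s k \<rho>" "g \<in> M_SL \<iota> s k \<rho>"
    then show "f + g \<in> M_SL \<iota> s k \<rho>"
      by (simp add: M_SL_def funs_on_def slash hom plus_fun_def holomorphic_vec_add)
  next
    fix c f
    assume "f \<in> M_SL \<iota> s k \<rho>"
    then show "fun_scale s c f \<in> M_SL \<iota> s k \<rho>"
      by (simp add: M_SL_def funs_on_def slash hom fun_scale_def holomorphic_vec_scale)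
  qed
qed


section \<open>The induction map\<close>

lemma neg_i_powi_uminus: "(- \<i>) powi (- n) = \<i> powi n"
  by (simp add: power_int_minus flip: power_int_inverse)

lemma neg_i_powi_mult:
  "(- \<i>) powi n * \<i> powi n = 1"
  "\<i> powi n * \<i> powi n = (- 1) powi n"
  "(- \<i>) powi n * (- 1) powi n = \<i> powi n"
  by (simp_all flip: power_int_mult_distrib)

locale metaplectic_rep = vector_space s
  for s :: "complex \<Rightarrow> 'v \<Rightarrow> 'v::ab_group_add" +
  fixes \<iota> :: "mat2 \<times> (complex \<Rightarrow> complex) \<Rightarrow> mat2 \<times> int"
    and \<rho> :: "mat2 \<times> int \<Rightarrow> 'v \<Rightarrow> 'v"
  assumes embedding: "lifting_embedding \<iota>"
    and rho_hom: "\<rho> \<in> hom (SL2t \<iota>) (GL_group s)"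
begin

lemma SL2t_iff: "(\<gamma>, \<epsilon>) \<in> carrier (SL2t \<iota>) \<longleftrightarrow> \<gamma> \<in> SL2Z \<and> \<epsilon> \<in> {1, -1}"
  by (simp add: SL2t_carrier[OF embedding])

lemma rho_linear:
  assumes "x \<in> carrier (SL2t \<iota>)"
  shows "Vector_Spaces.linear s s (\<rho> x)"
  using rho_hom assms by (auto simp: hom_def GL_group_def)

lemma rep_R_linear:
  assumes "x \<in> carrier (SL2t \<iota>)"
  shows "Vector_Spaces.linear s s (rep_R \<rho> x)"
proof (cases x)
  case (Pair \<gamma> \<epsilon>)
  then have x: "\<gamma> \<in> SL2Z" "\<epsilon> \<in> {1, -1}"
    using assms by (auto simp: SL2t_iff)
  then have "\<epsilon> * B_sign \<gamma> \<in> {1, -1}"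
    using B_sign_sign[of \<gamma>] by auto
  then show ?thesis
    using x by (simp add: Pair rep_R_eq rho_linear SL2t_iff SL2Z_conj_R)
qed

lemma rho_scale: "\<gamma> \<in> SL2Z \<Longrightarrow> \<epsilon> \<in> {1, -1} \<Longrightarrow> \<rho> (\<gamma>, \<epsilon>) (s c v) = s c (\<rho> (\<gamma>, \<epsilon>) v)"
  and rep_R_scale: "\<gamma> \<in> SL2Z \<Longrightarrow> \<epsilon> \<in> {1, -1} \<Longrightarrow>
    rep_R \<rho> (\<gamma>, \<epsilon>) (s c v) = s c (rep_R \<rho> (\<gamma>, \<epsilon>) v)"
proof -
  have scale: "T (s c v) = s c (T v)" if "Vector_Spaces.linear s s T" for T
  proof -
    interpret T: Vector_Spaces.linear s s T by fact
    show ?thesis by (rule T.scale)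
  qed
  show "\<rho> (\<gamma>, \<epsilon>) (s c v) = s c (\<rho> (\<gamma>, \<epsilon>) v)"
    "rep_R \<rho> (\<gamma>, \<epsilon>) (s c v) = s c (rep_R \<rho> (\<gamma>, \<epsilon>) v)"
    if "\<gamma> \<in> SL2Z" "\<epsilon> \<in> {1, -1}"
    using that by (auto intro!: scale rho_linear rep_R_linear simp: SL2t_iff)
qed

lemma rho_central:
  assumes "\<gamma> \<in> SL2Z" "\<epsilon> \<in> {1, -1}" "\<zeta> \<in> {1, -1}"
  shows "\<rho> (mat 1, \<zeta>) (\<rho> (\<gamma>, \<epsilon>) v) = \<rho> (\<gamma>, \<zeta> * \<epsilon>) v"
proof -
  have "mat 1 \<in> SL2Z"
    by (simp add: SL2Z_def)
  then have "\<rho> ((mat 1, \<zeta>) \<otimes>\<^bsub>SL2t \<iota>\<^esub> (\<gamma>, \<epsilon>)) = \<rho> (mat 1, \<zeta>) \<circ> \<rho> (\<gamma>, \<epsilon>)"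
    using hom_mult[OF rho_hom, of "(mat 1, \<zeta>)" "(\<gamma>, \<epsilon>)"] assms
    by (simp add: SL2t_iff GL_group_def)
  moreover have "(mat 1, \<zeta>) \<otimes>\<^bsub>SL2t \<iota>\<^esub> (\<gamma>, \<epsilon>) = (\<gamma>, \<zeta> * \<epsilon>)"
    using A_cocycle_one_left[OF assms(1)] by (simp add: SL2t_def GL2t_mult)
  ultimately show ?thesis
    by (metis comp_apply)
qed

lemma rho_one: "\<rho> (mat 1, 1) v = v"
proof -
  have one: "mat 1 \<in> SL2Z"
    by (simp add: SL2Z_def)
  then have "\<rho> (mat 1, 1) \<in> carrier (GL_group s)"
    using hom_in_carrier[OF rho_hom] by (simp add: SL2t_iff)
  then have "inj (\<rho> (mat 1, 1))"
    by (simp add: GL_group_def bij_is_inj)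
  moreover have "\<rho> (mat 1, 1) (\<rho> (mat 1, 1) v) = \<rho> (mat 1, 1) v"
    using rho_central[OF one, of 1 1] by simp
  ultimately show ?thesis
    by (rule injD)
qed

lemma Ind_rep_SL:
  assumes "\<gamma> \<in> SL2Z" "\<epsilon> \<in> {1, -1}"
  shows "Ind_rep \<iota> \<rho> (\<gamma>, \<epsilon>) p = (\<rho> (\<gamma>, \<epsilon>) (fst p), rep_R \<rho> (\<gamma>, \<epsilon>) (snd p))"
  using assms by (simp add: Ind_rep_def SL2t_iff case_prod_beta)

text \<open>The sign of \<open>\<eta>\<close> comes from the inverse \<open>[R, -1]\<close> of the lift of \<open>R\<close>, and the factor \<open>[I, -1]\<close> in the
  second row of the induced representation turns \<open>\<eta>\<close> into \<open>- \<eta>\<close>.\<close>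

lemma Ind_rep_R:
  assumes "\<delta> \<in> SL2Z" "\<epsilon> \<in> {1, -1}"
    and "\<eta> = - A_cocycle R_mat (R_mat ** \<delta>) * \<epsilon>"
  shows "Ind_rep \<iota> \<rho> (R_mat ** \<delta>, \<epsilon>) (v, w) = (rep_R \<rho> (\<delta>, \<eta>) w, \<rho> (\<delta>, - \<eta>) v)"
proof -
  have \<eta>: "\<eta> \<in> {1, -1}"
    using assms(2,3) A_cocycle_sign[of R_mat "R_mat ** \<delta>"] by auto
  have "(R_mat ** \<delta>, \<epsilon>) \<notin> carrier (SL2t \<iota>)"
    using assms by (simp add: SL2t_iff SL2Z_def det_mul det_R_mat)
  moreover have "inv\<^bsub>GL2t\<^esub> R_tilde \<otimes>\<^bsub>GL2t\<^esub> (R_mat ** \<delta>, \<epsilon>) = (\<delta>, \<eta>)"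
    by (simp add: inv_R_tilde GL2t_mult R_mat_cancel assms(3))
  ultimately show ?thesis
    using rho_central[OF assms(1) \<eta>, of "-1"] by (simp add: Ind_rep_def)
qed

lemma M_SL_transform:
  assumes "f \<in> M_SL \<iota> s k \<sigma>" "\<gamma> \<in> SL2Z" "\<epsilon> \<in> {1, -1}" "z \<in> Hplus"
  shows "s ((of_int \<epsilon> * phi_plus \<iota> \<gamma> z) powi - twice k) (f (act \<gamma> z)) = \<sigma> (\<gamma>, \<epsilon>) (f z)"
proof -
  have "(\<gamma>, \<epsilon>) \<in> carrier (SL2t \<iota>)"
    using assms by (simp add: SL2t_iff)
  then have "slash_SL \<iota> s k f (\<gamma>, \<epsilon>) z = \<sigma> (\<gamma>, \<epsilon>) (f z)"
    using assms(1,4) unfolding M_SL_def by blast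
  then show ?thesis
    by (simp add: slash_SL_def)
qed

text \<open>On values of forms the central element \<open>[I, -1]\<close> acts by \<open>(-1)\<^sup>2\<^sup>k\<close>, although the representation
  on the whole space may act differently.\<close>

lemma M_SL_sign:
  assumes "f \<in> M_SL \<iota> s k \<sigma>" "\<gamma> \<in> SL2Z" "\<epsilon> \<in> {1, -1}" "z \<in> Hplus"
  shows "\<sigma> (\<gamma>, - \<epsilon>) (f z) = s ((- 1) powi twice k) (\<sigma> (\<gamma>, \<epsilon>) (f z))"
proof -
  have "- \<epsilon> \<in> {1, -1}"
    using assms(3) by auto
  then have "\<sigma> (\<gamma>, - \<epsilon>) (f z)
      = s ((of_int (- \<epsilon>) * phi_plus \<iota> \<gamma> z) powi - twice k) (f (act \<gamma> z))"
    using M_SL_transform assms by metis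
  also have "of_int (- \<epsilon>) * phi_plus \<iota> \<gamma> z = (- 1) * (of_int \<epsilon> * phi_plus \<iota> \<gamma> z)"
    by simp
  also have "\<dots> powi - twice k
      = (- 1) powi twice k * (of_int \<epsilon> * phi_plus \<iota> \<gamma> z) powi - twice k"
    by (simp only: power_int_mult_distrib power_int_minus_one_minus)
  finally show ?thesis
    using M_SL_transform[OF assms] by (simp flip: scale_scale)
qed

lemma Ind_map_Hplus: "z \<in> Hplus \<Longrightarrow> Ind_map s k (f, g) z = (f z, g z)"
  by (simp add: Ind_map_def)

lemma Ind_map_Hminus:
  "z \<in> Hminus \<Longrightarrow>
    Ind_map s k (f, g) z = (s ((- \<i>) powi twice k) (g (- z)), s (\<i> powi twice k) (f (- z)))"
  by (simp add: Ind_map_def Hminus_not_Hplus)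

text \<open>Each of the four combinations of determinant and half-plane is reduced to the law for \<open>f\<close> and \<open>g\<close>
  under an element of determinant one at a point of the upper half-plane: in the lower half-plane
  the point is replaced by \<open>w = - z\<close> and the matrix by its conjugate under \<open>R\<close>, and for determinant
  \<open>-1\<close> the matrix is first replaced by \<open>\<delta> = R\<gamma>\<close>.\<close>

lemma slash_Ind_map:
  assumes f: "f \<in> M_SL \<iota> s k \<rho>" and g: "g \<in> M_SL \<iota> s k (rep_R \<rho>)"
    and x: "(\<gamma>, \<epsilon>) \<in> carrier GL2t" and z: "z \<in> Hstar"
  shows "slash_GL \<iota> (pair_scale s) k (Ind_map s k (f, g)) (\<gamma>, \<epsilon>) z
    = Ind_rep \<iota> \<rho> (\<gamma>, \<epsilon>) (Ind_map s k (f, g) z)"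
proof -
  have ps: "pair_scale s c (v, w) = (s c v, s c w)" for c v w
    by (simp add: pair_scale_eq[OF vector_space_axioms])
  have \<epsilon>: "\<epsilon> \<in> {1, -1}" and \<gamma>: "\<gamma> \<in> GL2Z"
    using x by (auto simp: GL2t_carrier)
  from \<gamma> show ?thesis
  proof (cases rule: GL2Z_det_cases)
    case 1
    then have SL: "\<gamma> \<in> SL2Z"
      by (simp add: SL2Z_def)
    show ?thesis
    proof (cases "z \<in> Hplus")
      case True
      then show ?thesis
        using act_Hplus[OF SL True] M_SL_transform[OF f SL \<epsilon> True] M_SL_transform[OF g SL \<epsilon> True] 1
        by (simp add: slash_GL_def Ind_map_Hplus ps Ind_rep_SL[OF SL \<epsilon>])
    next
      case False
      define w \<gamma>' \<epsilon>' where "w = - z" and "\<gamma>' = R_mat ** \<gamma> ** R_mat" and "\<epsilon>' = \<epsilon> * B_sign \<gamma>"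
      have zm: "z \<in> Hminus" and w: "w \<in> Hplus"
        using False z by (auto simp: w_def Hstar_def Hplus_uminus_iff)
      have SL': "\<gamma>' \<in> SL2Z" and \<epsilon>': "\<epsilon>' \<in> {1, -1}"
        using SL \<epsilon> B_sign_sign[of \<gamma>] by (auto simp: \<gamma>'_def \<epsilon>'_def SL2Z_conj_R)
      have act: "act \<gamma> z = - act \<gamma>' w"
        by (simp add: \<gamma>'_def w_def act_R_left act_R_right flip: matrix_mul_assoc)
      have minus: "act \<gamma> z \<in> Hminus"
        using act_Hplus[OF SL' w] by (simp add: act Hminus_uminus_iff)
      have rho: "rep_R \<rho> (\<gamma>', \<epsilon>') = \<rho> (\<gamma>, \<epsilon>)" "\<rho> (\<gamma>', \<epsilon>') = rep_R \<rho> (\<gamma>, \<epsilon>)"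
        unfolding \<gamma>'_def \<epsilon>'_def by (rule rep_R_conj_R[OF SL] rep_R_eq[OF SL, symmetric])+
      have "slash_GL \<iota> (pair_scale s) k (Ind_map s k (f, g)) (\<gamma>, \<epsilon>) z
          = (s ((- \<i>) powi twice k) (s ((of_int \<epsilon>' * phi_plus \<iota> \<gamma>' w) powi - twice k) (g (act \<gamma>' w))),
             s (\<i> powi twice k) (s ((of_int \<epsilon>' * phi_plus \<iota> \<gamma>' w) powi - twice k) (f (act \<gamma>' w))))"
        using 1 False by (simp add: slash_GL_def Ind_map_Hminus[OF minus] ps w_def[symmetric]
            \<gamma>'_def[symmetric] \<epsilon>'_def mult.commute) (simp add: act)
      also have "\<dots> = (s ((- \<i>) powi twice k) (\<rho> (\<gamma>, \<epsilon>) (g w)),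
          s (\<i> powi twice k) (rep_R \<rho> (\<gamma>, \<epsilon>) (f w)))"
        by (simp only: M_SL_transform[OF f SL' \<epsilon>' w] M_SL_transform[OF g SL' \<epsilon>' w] rho)
      finally show ?thesis
        using SL \<epsilon>
        by (simp only: Ind_map_Hminus[OF zm] Ind_rep_SL fst_conv snd_conv w_def rho_scale rep_R_scale)
    qed
  next
    case 2
    define \<delta> \<eta> where "\<delta> = R_mat ** \<gamma>" and "\<eta> = - A_cocycle R_mat \<gamma> * \<epsilon>"
    have \<gamma>_eq: "\<gamma> = R_mat ** \<delta>"
      by (simp add: \<delta>_def R_mat_cancel)
    have SL: "\<delta> \<in> SL2Z"
      using 2 by (simp add: \<delta>_def SL2Z_def det_mul det_R_mat)
    have \<eta>: "\<eta> \<in> {1, -1}"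
      using \<epsilon> A_cocycle_sign[of R_mat \<gamma>] by (auto simp: \<eta>_def)
    have Ind: "Ind_rep \<iota> \<rho> (\<gamma>, \<epsilon>) (u, v) = (rep_R \<rho> (\<delta>, \<eta>) v, \<rho> (\<delta>, - \<eta>) u)" for u v
      using Ind_rep_R[OF SL \<epsilon>] by (simp add: \<eta>_def flip: \<gamma>_eq)
    \<comment> \<open>In terms of \<open>\<eta>\<close> the factor \<open>\<i>\<close> of the action becomes \<open>- \<i>\<close>.\<close>
    have powi: "((- \<i>) * c) powi - twice k = \<i> powi twice k * c powi - twice k" for c
      by (simp only: power_int_mult_distrib neg_i_powi_uminus)
    show ?thesis
    proof (cases "z \<in> Hplus")
      case True
      define j where "j = (of_int \<eta> * phi_plus \<iota> \<delta> z) powi - twice k"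
      have act: "act \<gamma> z = - act \<delta> z"
        by (simp add: \<gamma>_eq act_R_left)
      have minus: "act \<gamma> z \<in> Hminus"
        using act_Hplus[OF SL True] by (simp add: act Hminus_uminus_iff)
      have "\<i> * of_int \<epsilon> * of_int (A_cocycle R_mat \<gamma>) * phi_plus \<iota> (R_mat ** \<gamma>) z
          = (- \<i>) * (of_int \<eta> * phi_plus \<iota> \<delta> z)"
        by (simp add: \<eta>_def \<delta>_def)
      then have "slash_GL \<iota> (pair_scale s) k (Ind_map s k (f, g)) (\<gamma>, \<epsilon>) z
          = pair_scale s (\<i> powi twice k * j) (Ind_map s k (f, g) (act \<gamma> z))"
        using 2 True powi by (simp add: slash_GL_def j_def)
      also have "\<dots> = (s ((- \<i>) powi twice k * \<i> powi twice k) (s j (g (act \<delta> z))),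
          s (\<i> powi twice k * \<i> powi twice k) (s j (f (act \<delta> z))))"
        unfolding Ind_map_Hminus[OF minus] unfolding act by (simp add: ps mult_ac)
      also have "\<dots> = (rep_R \<rho> (\<delta>, \<eta>) (g z), s ((- 1) powi twice k) (\<rho> (\<delta>, \<eta>) (f z)))"
        unfolding j_def M_SL_transform[OF f SL \<eta> True] M_SL_transform[OF g SL \<eta> True]
          neg_i_powi_mult by simp
      finally show ?thesis
        by (simp add: Ind_map_Hplus[OF True] Ind M_SL_sign[OF f SL \<eta> True])
    next
      case False
      define w \<delta>' \<eta>' where "w = - z" and "\<delta>' = R_mat ** \<delta> ** R_mat" and "\<eta>' = \<eta> * B_sign \<delta>"
      define j where "j = (of_int \<eta>' * phi_plus \<iota> \<delta>' w) powi - twice k"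
      have zm: "z \<in> Hminus" and w: "w \<in> Hplus"
        using False z by (auto simp: w_def Hstar_def Hplus_uminus_iff)
      have SL': "\<delta>' \<in> SL2Z" and \<eta>': "\<eta>' \<in> {1, -1}"
        using SL \<eta> B_sign_sign[of \<delta>] by (auto simp: \<delta>'_def \<eta>'_def SL2Z_conj_R)
      have \<delta>': "\<delta>' = \<gamma> ** R_mat"
        by (simp add: \<delta>'_def \<gamma>_eq)
      have act: "act \<gamma> z = act \<delta>' w"
        by (simp add: \<delta>' w_def act_R_right)
      have rho: "rep_R \<rho> (\<delta>', \<eta>') = \<rho> (\<delta>, \<eta>)" "\<rho> (\<delta>', \<eta>') = rep_R \<rho> (\<delta>, \<eta>)"
        "rep_R \<rho> (\<delta>', - \<eta>') = \<rho> (\<delta>, - \<eta>)"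
        unfolding \<delta>'_def \<eta>'_def mult_minus_left[symmetric]
        by (rule rep_R_conj_R[OF SL] rep_R_eq[OF SL, symmetric])+
      have "\<i> * of_int \<epsilon> * of_int (A_cocycle R_mat \<gamma>) * of_int (B_sign (R_mat ** \<gamma>)) *
            phi_plus \<iota> (\<gamma> ** R_mat) (- z) = (- \<i>) * (of_int \<eta>' * phi_plus \<iota> \<delta>' w)"
        unfolding \<delta>' by (simp add: \<eta>'_def \<eta>_def \<delta>_def w_def)
      then have "slash_GL \<iota> (pair_scale s) k (Ind_map s k (f, g)) (\<gamma>, \<epsilon>) z
          = pair_scale s (\<i> powi twice k * j) (f (act \<delta>' w), g (act \<delta>' w))"
        using 2 False powi Ind_map_Hplus[OF act_Hplus[OF SL' w]]
        by (simp add: slash_GL_def j_def act)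
      also have "\<dots> = (s (\<i> powi twice k) (s j (f (act \<delta>' w))), s (\<i> powi twice k) (s j (g (act \<delta>' w))))"
        by (simp add: ps)
      also have "\<dots> = (s (\<i> powi twice k) (rep_R \<rho> (\<delta>, \<eta>) (f w)), s (\<i> powi twice k) (\<rho> (\<delta>, \<eta>) (g w)))"
        unfolding j_def M_SL_transform[OF f SL' \<eta>' w] M_SL_transform[OF g SL' \<eta>' w] rho ..
      finally have slash: "slash_GL \<iota> (pair_scale s) k (Ind_map s k (f, g)) (\<gamma>, \<epsilon>) z
        = (s (\<i> powi twice k) (rep_R \<rho> (\<delta>, \<eta>) (f w)), s (\<i> powi twice k) (\<rho> (\<delta>, \<eta>) (g w)))" .
      have \<eta>m: "- \<eta> \<in> {1, -1}"
        using \<eta> by auto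
      have "\<rho> (\<delta>, - \<eta>) (g w) = s ((- 1) powi twice k) (\<rho> (\<delta>, \<eta>) (g w))"
        using M_SL_sign[OF g SL' \<eta>' w] by (simp only: rho)
      then have "s ((- \<i>) powi twice k) (\<rho> (\<delta>, - \<eta>) (g w)) = s (\<i> powi twice k) (\<rho> (\<delta>, \<eta>) (g w))"
        by (simp only: scale_scale neg_i_powi_mult)
      then show ?thesis
        by (simp only: slash Ind_map_Hminus[OF zm] Ind rho_scale[OF SL \<eta>m] rep_R_scale[OF SL \<eta>]
            flip: w_def)
    qed
  qed
qed

lemma Ind_map_in_M_GL:
  assumes f: "f \<in> M_SL \<iota> s k \<rho>" and g: "g \<in> M_SL \<iota> s k (rep_R \<rho>)"
  shows "Ind_map s k (f, g) \<in> M_GL \<iota> (pair_scale s) k (Ind_rep \<iota> \<rho>)"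
proof -
  have hol: "holomorphic_vec s Hplus f" "holomorphic_vec s Hplus g"
    using f g by (simp_all add: M_SL_def)
  have "holomorphic_vec (pair_scale s) Hplus (\<lambda>z. (f z, g z))"
    using hol by (simp add: holomorphic_vec_Pair_iff[OF vector_space_axioms])
  then have "holomorphic_vec (pair_scale s) Hplus (Ind_map s k (f, g))"
    by (rule holomorphic_vec_cong[THEN iffD1, rotated]) (simp add: Ind_map_Hplus)
  moreover have "holomorphic_vec (pair_scale s) Hminus
      (\<lambda>z. (s ((- \<i>) powi twice k) (g (- z)), s (\<i> powi twice k) (f (- z))))"
    unfolding holomorphic_vec_Pair_iff[OF vector_space_axioms] fst_conv snd_conv
    using hol by (intro conjI holomorphic_vec_scale holomorphic_vec_reflect)
  then have "holomorphic_vec (pair_scale s) Hminus (Ind_map s k (f, g))"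
    by (rule holomorphic_vec_cong[THEN iffD1, rotated]) (simp add: Ind_map_Hminus)
  ultimately have "holomorphic_vec (pair_scale s) Hstar (Ind_map s k (f, g))"
    by (simp add: holomorphic_vec_Hstar)
  moreover have "Ind_map s k (f, g) \<in> funs_on Hstar"
    by (simp add: funs_on_def Hstar_def Ind_map_def)
  ultimately show ?thesis
    using slash_Ind_map[OF f g] by (auto simp: M_GL_def)
qed

text \<open>For determinant one both the action on the upper half-plane and the induced representation are
  diagonal, so the law for \<open>F\<close> splits into laws for its components.\<close>

lemma M_GL_restrict:
  assumes F: "F \<in> M_GL \<iota> (pair_scale s) k (Ind_rep \<iota> \<rho>)"
  defines "f \<equiv> \<lambda>z. if z \<in> Hplus then fst (F z) else 0"
    and "g \<equiv> \<lambda>z. if z \<in> Hplus then snd (F z) else 0"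
  shows "f \<in> M_SL \<iota> s k \<rho>" "g \<in> M_SL \<iota> s k (rep_R \<rho>)"
proof -
  have "holomorphic_vec (pair_scale s) Hplus F"
    using F by (simp add: M_GL_def holomorphic_vec_Hstar)
  then have hol: "holomorphic_vec s Hplus f" "holomorphic_vec s Hplus g"
    using holomorphic_vec_cong[of Hplus f "\<lambda>z. fst (F z)"]
      holomorphic_vec_cong[of Hplus g "\<lambda>z. snd (F z)"]
    by (simp_all add: f_def g_def holomorphic_vec_Pair_iff[OF vector_space_axioms])
  have "slash_SL \<iota> s k f x z = \<rho> x (f z) \<and> slash_SL \<iota> s k g x z = rep_R \<rho> x (g z)"
    if x: "x \<in> carrier (SL2t \<iota>)" and z: "z \<in> Hplus" for x z
  proof (cases x)
    case (Pair \<gamma> \<epsilon>)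
    then have SL: "\<gamma> \<in> SL2Z" and \<epsilon>: "\<epsilon> \<in> {1, -1}"
      using x by (simp_all add: SL2t_iff)
    have "x \<in> carrier GL2t"
      using x embedding by (auto simp: SL2t_def lifting_embedding_def mon_def hom_def)
    then have "slash_GL \<iota> (pair_scale s) k F x z = Ind_rep \<iota> \<rho> x (fst (F z), snd (F z))"
      using F z by (simp add: M_GL_def Hstar_def)
    then show ?thesis
      using z SL \<epsilon> act_Hplus[OF SL z]
      by (simp add: Pair slash_GL_def slash_SL_def Ind_rep_SL f_def g_def SL2Z_def
          pair_scale_eq[OF vector_space_axioms])
  qed
  then show "f \<in> M_SL \<iota> s k \<rho>" "g \<in> M_SL \<iota> s k (rep_R \<rho>)"
    using hol by (simp_all add: M_SL_def funs_on_def f_def g_def)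
qed

text \<open>The transformation law for the lift of \<open>R\<close> itself: its factor is \<open>\<i> A(R, R) = - \<i>\<close>, and the
  induced representation swaps the components, up to \<open>[I, -1]\<close>, which acts by \<open>(-1)\<^sup>2\<^sup>k\<close> here because
  the first component of \<open>F\<close> is itself a form for \<open>\<rho>\<close>.\<close>

lemma M_GL_Hminus:
  assumes F: "F \<in> M_GL \<iota> (pair_scale s) k (Ind_rep \<iota> \<rho>)" and z: "z \<in> Hplus"
  shows "F (- z) = (s ((- \<i>) powi twice k) (snd (F z)), s (\<i> powi twice k) (fst (F z)))"
proof -
  have one: "mat 1 \<in> SL2Z" and R: "R_mat = R_mat ** mat 1"
    by (simp_all add: SL2Z_def)
  have "z \<in> Hstar"
    using z by (simp add: Hstar_def)
  then have "slash_GL \<iota> (pair_scale s) k F R_tilde z = Ind_rep \<iota> \<rho> R_tilde (F z)"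
    using F R_tilde_carrier unfolding M_GL_def by blast
  moreover have "slash_GL \<iota> (pair_scale s) k F R_tilde z = pair_scale s (\<i> powi twice k) (F (- z))"
    using z act_R_left[of "mat 1" z]
    by (simp add: slash_GL_def R_tilde_def det_R_mat A_cocycle_R_R R_mat_square act_one
        phi_plus_one[OF embedding] neg_i_powi_uminus)
  moreover have "Ind_rep \<iota> \<rho> R_tilde (F z) = (snd (F z), \<rho> (mat 1, -1) (fst (F z)))"
  proof -
    have "rep_R \<rho> (mat 1, 1) v = v" for v
      using rho_one by (simp add: rep_R_eq[OF one] R_mat_square B_sign_def chi_def mat2_one
          R_mat_entries hilbert_symbol_def)
    then show ?thesis
      using Ind_rep_R[OF one, of 1 1 "fst (F z)" "snd (F z)"]
      by (simp add: R_tilde_def A_cocycle_R_R)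
  qed
  moreover have "\<rho> (mat 1, -1) (fst (F z)) = s ((- 1) powi twice k) (fst (F z))"
    using M_SL_sign[OF M_GL_restrict(1)[OF F] one, of 1 z] z by (simp add: rho_one)
  ultimately have "pair_scale s (\<i> powi twice k) (F (- z))
      = (snd (F z), s ((- 1) powi twice k) (fst (F z)))"
    by metis
  then have "pair_scale s ((- \<i>) powi twice k) (pair_scale s (\<i> powi twice k) (F (- z)))
      = pair_scale s ((- \<i>) powi twice k) (snd (F z), s ((- 1) powi twice k) (fst (F z)))"
    by (rule arg_cong)
  then show ?thesis
    by (simp add: pair_scale_eq[OF vector_space_axioms] neg_i_powi_mult)
qed

lemma bij_betw_Ind_map:
  "bij_betw (Ind_map s k) (M_SL \<iota> s k \<rho> \<times> M_SL \<iota> s k (rep_R \<rho>))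
     (M_GL \<iota> (pair_scale s) k (Ind_rep \<iota> \<rho>))"
proof (rule bij_betwI)
  let ?res = "\<lambda>F. (\<lambda>z. if z \<in> Hplus then fst (F z) else 0, \<lambda>z. if z \<in> Hplus then snd (F z) else 0)"
  show "Ind_map s k \<in> M_SL \<iota> s k \<rho> \<times> M_SL \<iota> s k (rep_R \<rho>) \<rightarrow> M_GL \<iota> (pair_scale s) k (Ind_rep \<iota> \<rho>)"
    using Ind_map_in_M_GL by auto
  show "?res \<in> M_GL \<iota> (pair_scale s) k (Ind_rep \<iota> \<rho>) \<rightarrow> M_SL \<iota> s k \<rho> \<times> M_SL \<iota> s k (rep_R \<rho>)"
    using M_GL_restrict by auto
  show "?res (Ind_map s k p) = p" if "p \<in> M_SL \<iota> s k \<rho> \<times> M_SL \<iota> s k (rep_R \<rho>)" for p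
    using that by (auto simp: M_SL_def funs_on_def Ind_map_Hplus)
  show "Ind_map s k (?res F) = F" if F: "F \<in> M_GL \<iota> (pair_scale s) k (Ind_rep \<iota> \<rho>)" for F
  proof
    fix z
    consider "z \<in> Hplus" | "z \<in> Hminus" | "z \<notin> Hstar"
      by (auto simp: Hstar_def)
    then show "Ind_map s k (?res F) z = F z"
    proof cases
      case 1
      then show ?thesis
        by (simp add: Ind_map_Hplus)
    next
      case 2
      then show ?thesis
        using M_GL_Hminus[OF F, of "- z"] by (simp add: Ind_map_Hminus Hplus_uminus_iff)
    next
      case 3
      then show ?thesis
        using F by (simp add: Ind_map_def Hstar_def M_GL_def funs_on_def)
    qed
  qed
qed

lemma Ind_map_add: "Ind_map s k (p + q) = Ind_map s k p + Ind_map s k q"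
  by (cases p; cases q) (auto simp: Ind_map_def scale_right_distrib zero_prod_def)

lemma Ind_map_scale:
  "Ind_map s k (module_prod.scale (fun_scale s) (fun_scale s) c p)
    = fun_scale (pair_scale s) c (Ind_map s k p)"
proof -
  have "module_prod.scale (fun_scale s) (fun_scale s) c p = pair_scale (fun_scale s) c p"
    by (simp add: pair_scale_def)
  then show ?thesis
    by (cases p) (auto simp: pair_scale_eq[OF vector_space_axioms] zero_prod_def
        pair_scale_eq[OF vector_space_fun_scale[OF vector_space_axioms]]
        fun_scale_def Ind_map_def mult.commute)
qed

end

text \<open>The image of a subspace under a map that is linear on it is a subspace. For induction this
  yields that the forms for the induced representation are a subspace.\<close>

lemma subspace_iso_of_bij_betw:
  assumes "module s" "module t" "module.subspace s S"
    and add: "\<And>x y. x \<in> S \<Longrightarrow> y \<in> S \<Longrightarrow> h (x + y) = h x + h y"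
    and scale: "\<And>c x. x \<in> S \<Longrightarrow> h (s c x) = t c (h x)"
    and bij: "bij_betw h S T"
  shows "subspace_iso s t S T h"
proof -
  interpret s: module s by fact
  interpret t: module t by fact
  have T: "T = h ` S"
    using bij by (simp add: bij_betw_def)
  have "t.subspace T"
    unfolding t.subspace_def
  proof (intro conjI ballI allI)
    have "h 0 = t 0 (h 0)"
      using scale[of 0 0] s.subspace_0[OF assms(3)] by simp
    then show "0 \<in> T"
      using s.subspace_0[OF assms(3)] by (auto simp: T)
  next
    fix x y
    assume "x \<in> T" "y \<in> T"
    then show "x + y \<in> T"
      using s.subspace_add[OF assms(3)] by (auto simp: T simp flip: add)
  next
    fix c x
    assume "x \<in> T"
    then show "t c x \<in> T"
      using s.subspace_scale[OF assms(3)] by (auto simp: T simp flip: scale)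
  qed
  then show ?thesis
    using assms by (simp add: subspace_iso_def)
qed

theorem theoremV2:
  fixes k :: real
    and s :: "complex \<Rightarrow> 'v \<Rightarrow> 'v::ab_group_add"
    and \<iota> :: "mat2 \<times> (complex \<Rightarrow> complex) \<Rightarrow> mat2 \<times> int"
    and \<rho> :: "mat2 \<times> int \<Rightarrow> 'v \<Rightarrow> 'v"
  assumes "2 * k \<in> \<int>"
    and "vector_space s"
    and "lifting_embedding \<iota>"
    and "\<rho> \<in> hom (SL2t \<iota>) (GL_group s)"
  shows "subspace_iso
           (module_prod.scale (fun_scale s) (fun_scale s)) (fun_scale (pair_scale s))
           (M_SL \<iota> s k \<rho> \<times> M_SL \<iota> s k (rep_R \<rho>))
           (M_GL \<iota> (pair_scale s) k (Ind_rep \<iota> \<rho>))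
           (Ind_map s k)"
proof -
  interpret metaplectic_rep s \<iota> \<rho>
    using assms by (simp add: metaplectic_rep_def metaplectic_rep_axioms_def)
  interpret fs: vector_space "fun_scale s"
    by (rule vector_space_fun_scale) fact
  interpret fp: vector_space "fun_scale (pair_scale s)"
    by (intro vector_space_fun_scale vector_space_pair_scale) fact
  interpret prod: module_prod "fun_scale s" "fun_scale s"
    by (simp add: module_prod_def module_pair_def fs.module_axioms)
  show ?thesis
  proof (rule subspace_iso_of_bij_betw)
    show "prod.p.subspace (M_SL \<iota> s k \<rho> \<times> M_SL \<iota> s k (rep_R \<rho>))"
      using assms(2) by (intro prod.subspace_Times subspace_M_SL rho_linear rep_R_linear)
  qed (rule prod.p.module_axioms fp.module_axioms Ind_map_add Ind_map_scale bij_betw_Ind_map)+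
qed

end
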